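(* Let $k\ge1$. The sets $U_C$, where $C$ runs through all configurations, form a partition of $\mathbb{Z}^{k+1}\setminus \mathrm{Sing}$ (they are pairwise disjoint, some possibly empty, and their union is $\mathbb{Z}^{k+1}\setminus\mathrm{Sing}$), and each $U_C$ is the set of integer points of a finite polyhedral complex in $\mathbb{R}^{k+1}$ in which every polyhedron is given by finitely many integer linear constraints, each of the form $x(j)-x(l)=c$ or $x(j)-x(l)\ge c$ with $0\le j,l\le k$, $c\in\mathbb{Z}$. The polyhedral complex of $U_{C_0}$ corresponding to the configuration $C_0=\{\{i,\star\}: 0\le i<k\}$ has full dimension $k+1$.
   Context: A tropical linear differential equation of order $k$ in one unknown is $P=\min_{0\le i\le k}\{a_i+u^{(i)}\}$, $a_i\in\mathbb{Z}$; it is identified with the point $(a_0,\dots,a_k)\in\mathbb{Z}^{k+1}$ (coordinates $x(0),\dots,x(k)$). For $S\subseteq\mathbb{Z}_{\ge0}$, $\mathrm{val}_S(i)=\min\{s-i:s\in S,\ s\ge i\}$ ($\infty$ if no such $s$). A nonempty $S\subseteq\mathbb{Z}_{\ge 0}$ is a solution of $P$ if $\min_{0\le i\le k}\{a_i+\mathrm{val}_S(i)\}$ is attained for at least two $i$. $\mu(\mathrm{Sol}(P))$ is the set of inclusion-minimal nonempty solutions; $P$ is holonomic if this set is finite. $\mathrm{Sing}\subset\mathbb{Z}^{k+1}$ is the set of $P$ for which $\min_{0\le i\le k}\{a_i+k-i\}$ is attained at least twice (equivalently, the set of non-holonomic $P$). For holonomic $P$, every minimal solution has the form $\{j,l\}$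 with $0\le j\le l<k$, or $\{p,q\}$ with $0\le p<k\le q$, with at most one such $q$ for each $p$. A configuration is a set $C$ of symbols of the forms $\{j,l\}$ with $0\le j\le l<k$ and $\{p,\star\}$ with $0\le p<k$, where $\star$ stands for an unspecified integer $q\ge k$. One says that $\mu(\mathrm{Sol}(P))=C$ if for all $0\le j\le l<k$ the set $\{j,l\}$ is a minimal solution iff $\{j,l\}\in C$, and for all $0\le p<k$ there is $q\ge k$ with $\{p,q\}$ a minimal solution iff $\{p,\star\}\in C$. $U_C\subset\mathbb{Z}^{k+1}$ is the set of holonomic $P$ with $\mu(\mathrm{Sol}(P))=C$. *)

theory Defs
  imports "HOL-Analysis.Analysis"
begin

text \<open>
  A tropical linear differential equation of order \<open>k\<close> is given by its coefficients
  \<open>a 0, \<dots>, a k\<close>, where \<open>a :: nat \<Rightarrow> int\<close>; values of \<open>a\<close> beyond \<open>k\<close> are never used.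
\<close>

definition attained_twice :: "nat \<Rightarrow> (nat \<Rightarrow> 'a::linorder) \<Rightarrow> bool" where
  "attained_twice k f \<longleftrightarrow> 2 \<le> card {i \<in> {0..k}. f i = Min (f ` {0..k})}"

text \<open>The infimum over the empty set is \<open>\<infinity>\<close> in \<^typ>\<open>enat\<close>.\<close>

definition trop_val :: "nat set \<Rightarrow> nat \<Rightarrow> enat" where
  "trop_val S i = (INF s\<in>{s\<in>S. i \<le> s}. enat (s - i))"

definition Sol :: "nat \<Rightarrow> (nat \<Rightarrow> int) \<Rightarrow> nat set set" where
  "Sol k a = {S. S \<noteq> {} \<and>
     attained_twice k (\<lambda>i. ereal (real_of_int (a i)) + ereal_of_enat (trop_val S i))}"

definition minimal_sets :: "'a set set \<Rightarrow> 'a set set" where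
  "minimal_sets F = {S \<in> F. \<forall>T\<in>F. T \<subseteq> S \<longrightarrow> T = S}"

definition holonomic :: "nat \<Rightarrow> (nat \<Rightarrow> int) \<Rightarrow> bool" where
  "holonomic k a \<longleftrightarrow> finite (minimal_sets (Sol k a))"

text \<open>
  \<open>Low {j, l}\<close> is the symbol \<open>{j, l}\<close> with \<open>j \<le> l < k\<close> (unordered, possibly a singleton);
  \<open>Star p\<close> is the symbol \<open>{p, \<star>}\<close>.
\<close>

datatype symb = Low "nat set" | Star nat

definition configurations :: "nat \<Rightarrow> symb set set" where
  "configurations k = Pow ({Low {j, l} | j l. j \<le> l \<and> l < k} \<union> {Star p | p. p < k})"

definition has_configuration :: "nat \<Rightarrow> (nat \<Rightarrow> int) \<Rightarrow> symb set \<Rightarrow> bool" where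
  "has_configuration k a C \<longleftrightarrow>
     (\<forall>j l. j \<le> l \<and> l < k \<longrightarrow> ({j, l} \<in> minimal_sets (Sol k a) \<longleftrightarrow> Low {j, l} \<in> C)) \<and>
     (\<forall>p<k. (\<exists>q\<ge>k. {p, q} \<in> minimal_sets (Sol k a)) \<longleftrightarrow> Star p \<in> C)"

text \<open>
  The spaces \<open>\<int>^(k+1)\<close> and \<open>\<real>^(k+1)\<close> are \<open>int ^ 'n\<close> and \<open>real ^ 'n\<close>, where the enumeration
  \<open>e\<close> is a bijection from \<open>{0..k}\<close> onto the index type \<open>'n\<close>; the coordinate \<open>x(j)\<close> is \<open>x $ e j\<close>.
\<close>

definition Sing :: "nat \<Rightarrow> (nat \<Rightarrow> 'n::finite) \<Rightarrow> (int ^ 'n) set" where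
  "Sing k e = {x. attained_twice k (\<lambda>i. x $ e i + int k - int i)}"

definition U :: "nat \<Rightarrow> (nat \<Rightarrow> 'n::finite) \<Rightarrow> symb set \<Rightarrow> (int ^ 'n) set" where
  "U k e C = {x. holonomic k (\<lambda>i. x $ e i) \<and> has_configuration k (\<lambda>i. x $ e i) C}"

definition integer_points :: "(real ^ 'n::finite) set \<Rightarrow> (int ^ 'n) set" where
  "integer_points X = {x. (\<chi> i. real_of_int (x $ i)) \<in> X}"

text \<open>
  As for \<^const>\<open>simplicial_complex\<close>, the empty set counts as a face, so it belongs to every
  nonempty complex.
\<close>

definition polyhedral_complex :: "'a::euclidean_space set set \<Rightarrow> bool" where
  "polyhedral_complex K \<longleftrightarrow>
     finite K \<and>
     (\<forall>P\<in>K. polyhedron P) \<and>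
     (\<forall>P\<in>K. \<forall>F. F face_of P \<longrightarrow> F \<in> K) \<and>
     (\<forall>P\<in>K. \<forall>Q\<in>K. (P \<inter> Q) face_of P \<and> (P \<inter> Q) face_of Q)"

definition complex_dim :: "'a::euclidean_space set set \<Rightarrow> int" where
  "complex_dim K = Max (aff_dim ` K)"

definition difference_constraint ::
    "nat \<Rightarrow> (nat \<Rightarrow> 'n::finite) \<Rightarrow> (real ^ 'n) set \<Rightarrow> bool" where
  "difference_constraint k e H \<longleftrightarrow>
     (\<exists>j\<le>k. \<exists>l\<le>k. \<exists>c::int.
        H = {x. x $ e j - x $ e l = of_int c} \<or> H = {x. x $ e j - x $ e l \<ge> of_int c})"

definition given_by_difference_constraints ::
    "nat \<Rightarrow> (nat \<Rightarrow> 'n::finite) \<Rightarrow> (real ^ 'n) set \<Rightarrow> bool" where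
  "given_by_difference_constraints k e P \<longleftrightarrow>
     (\<exists>\<H>. finite \<H> \<and> (\<forall>H\<in>\<H>. difference_constraint k e H) \<and> P = \<Inter>\<H>)"

end

theory Submission imports Defs begin

text \<open>
  Write \<open>a\<close> for the coefficients of the equation. The argument has three parts.

  \<^emph>\<open>Solutions.\<close> If the minimum for \<open>S\<close> is attained at \<open>i < j\<close>, then the least elements of \<open>S\<close>
  that are at least \<open>i\<close> and at least \<open>j\<close> already form a solution; so a minimal solution is
  some \<open>{s, t}\<close> (\<open>solution_pair\<close>). A singleton \<open>{q}\<close> with \<open>q \<ge> k\<close> is a solution iff \<open>{k}\<close> is one,
  iff \<open>a\<close> lies in \<open>Sing\<close>; in that case there are infinitely many minimal solutions. Otherwise
  \<open>s < k\<close>, and \<open>t \<le> k\<close> or \<open>t\<close> is determined by \<open>s\<close> and the two positions at which the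
  minimum is attained, so there are only finitely many (\<open>holonomic_iff\<close>). This gives the
  partition.

  \<^emph>\<open>Truncated differences.\<close> For \<open>T \<subseteq> {0..k}\<close>, being a solution depends only on the truth values
  of inequalities \<open>a i - a l \<le> c\<close> with \<open>\<bar>c\<bar> \<le> 2 k\<close>. Outside \<open>Sing\<close> the same holds for the existence
  of some \<open>q \<ge> k\<close> such that \<open>{p, q}\<close> is minimal: as \<open>q\<close> is free, the minimum over \<open>i > p\<close> can be
  lifted to any height above its value for \<open>q = k\<close>, so the only requirement, besides \<open>{p}\<close> not
  being a solution, is that this value does not exceed the minimum over \<open>i \<le> p\<close> (\<open>star_iff\<close>).
  Hence membership in \<open>U k e C\<close> depends only on the differences \<open>a i - a l\<close> truncated to
  \<open>[-N, N]\<close>, where \<open>N = 2 k + 1\<close> (\<open>U_cong\<close>).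

  \<^emph>\<open>Cells.\<close> Each pattern of truncated differences is cut out by difference constraints: an
  equation where the difference lies strictly between \<open>-N\<close> and \<open>N\<close>, and the inequality
  \<open>\<ge> N\<close> or \<open>\<le> -N\<close> elsewhere. Since the gaps between consecutive integers are left out, these
  polyhedra are pairwise disjoint (\<open>cells_disjoint\<close>), so all their faces together form a
  polyhedral complex with no gluing to check. The faces are again given by difference
  constraints (\<open>face_of_diff_polyhedron\<close>). For the configuration consisting of all \<open>Star i\<close>, the
  point \<open>x(i) = N (k - i)\<close> has distinct coordinates at distance at least \<open>N\<close> from each other, so
  its cell is cut out by inequalities only and is full-dimensional.
\<close>

section \<open>Solutions and minimal solutions\<close>

lemma attained_twice_iff:
  fixes f :: "nat \<Rightarrow> 'a::linorder"
  shows "attained_twice k f \<longleftrightarrow> (\<exists>i j. i < j \<and> j \<le> k \<and> f i = f j \<and> (\<forall>l\<le>k. f i \<le> f l))"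
proof -
  let ?m = "Min (f ` {0..k})"
  let ?A = "{i \<in> {0..k}. f i = ?m}"
  have min_iff: "f i = ?m \<longleftrightarrow> (\<forall>l\<le>k. f i \<le> f l)" if "i \<le> k" for i
  proof
    assume "f i = ?m"
    then show "\<forall>l\<le>k. f i \<le> f l" by simp
  next
    assume "\<forall>l\<le>k. f i \<le> f l"
    then show "f i = ?m" using that by (intro Min_eqI[symmetric]) auto
  qed
  have "2 \<le> card ?A \<longleftrightarrow> \<not> card ?A \<le> Suc 0" by auto
  also have "\<dots> \<longleftrightarrow> (\<exists>i\<in>?A. \<exists>j\<in>?A. i \<noteq> j)"
    by (subst card_le_Suc0_iff_eq) auto
  also have "\<dots> \<longleftrightarrow> (\<exists>i\<in>?A. \<exists>j\<in>?A. i < j)"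
    (is "?P \<longleftrightarrow> ?Q")
  proof
    assume ?P
    then obtain i j where "i \<in> ?A" "j \<in> ?A" "i \<noteq> j" by (elim bexE)
    moreover from this have "i < j \<or> j < i" by linarith
    ultimately show ?Q by blast
  qed auto
  also have "\<dots> \<longleftrightarrow> (\<exists>i j. i < j \<and> j \<le> k \<and> f i = f j \<and> (\<forall>l\<le>k. f i \<le> f l))"
    (is "?L \<longleftrightarrow> ?R")
  proof
    assume ?L
    then obtain i j where "i \<le> k" "j \<le> k" "i < j" "f i = ?m" "f j = ?m" by auto
    then show ?R using min_iff[of i] by (intro exI[of _ i] exI[of _ j]) auto
  next
    assume ?R
    then obtain i j where ij: "i < j" "j \<le> k" "f i = f j" "\<forall>l\<le>k. f i \<le> f l" by blast
    then have "f i = ?m" "f j = ?m" using min_iff[of i] min_iff[of j] by auto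
    with ij have "i \<in> ?A" "j \<in> ?A" by auto
    with ij show ?L by blast
  qed
  finally show ?thesis unfolding attained_twice_def .
qed

text \<open>
  The least element of \<open>S\<close> that is at least \<open>i\<close>; unspecified when \<open>S\<close> has no such element.
\<close>

definition nxt :: "nat set \<Rightarrow> nat \<Rightarrow> nat" where
  "nxt S i = (LEAST s. s \<in> S \<and> i \<le> s)"

lemma nxt_in: "s \<in> S \<Longrightarrow> i \<le> s \<Longrightarrow> nxt S i \<in> S"
  and nxt_ge: "s \<in> S \<Longrightarrow> i \<le> s \<Longrightarrow> i \<le> nxt S i"
  and nxt_le: "s \<in> S \<Longrightarrow> i \<le> s \<Longrightarrow> nxt S i \<le> s"
  unfolding nxt_def
  using LeastI[of "\<lambda>s. s \<in> S \<and> i \<le> s" s] Least_le[of "\<lambda>s. s \<in> S \<and> i \<le> s" s] by auto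

lemma nxt_eqI: "s \<in> S \<Longrightarrow> i \<le> s \<Longrightarrow> (\<And>t. t \<in> S \<Longrightarrow> i \<le> t \<Longrightarrow> s \<le> t) \<Longrightarrow> nxt S i = s"
  unfolding nxt_def by (rule Least_equality) auto

lemma trop_val_eq_nxt:
  assumes "s \<in> S" "i \<le> s"
  shows "trop_val S i = enat (nxt S i - i)"
proof (rule antisym)
  show "trop_val S i \<le> enat (nxt S i - i)"
    unfolding trop_val_def using nxt_in[OF assms] nxt_ge[OF assms] by (intro INF_lower) auto
  show "enat (nxt S i - i) \<le> trop_val S i"
    unfolding trop_val_def by (intro INF_greatest) (auto simp: diff_le_mono nxt_le)
qed

lemma trop_val_eq_infinity:
  assumes "\<not> (\<exists>s\<in>S. i \<le> s)"
  shows "trop_val S i = \<infinity>"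
proof -
  have "{s \<in> S. i \<le> s} = {}" using assms by auto
  then show ?thesis unfolding trop_val_def by (simp only: image_empty Inf_empty top_enat_def)
qed

text \<open>
  The \<open>i\<close>-th term \<open>a i + val\<^sub>S i\<close> of the tropical equation as an integer; meaningful only when
  \<open>S\<close> has an element that is at least \<open>i\<close>, the term being \<open>\<infinity>\<close> otherwise.
\<close>

definition weight :: "(nat \<Rightarrow> int) \<Rightarrow> nat set \<Rightarrow> nat \<Rightarrow> int" where
  "weight a S i = a i - int i + int (nxt S i)"

text \<open>
  Since \<open>S\<close> is nonempty, the term at \<open>0\<close> is finite, hence so is the minimum. It therefore
  suffices to compare the finite terms.
\<close>

lemma Sol_iff:
  "S \<in> Sol k a \<longleftrightarrow>
    (\<exists>i j. i < j \<and> j \<le> k \<and> (\<exists>s\<in>S. j \<le> s) \<and> weight a S i = weight a S j \<and>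
      (\<forall>l\<le>k. (\<exists>s\<in>S. l \<le> s) \<longrightarrow> weight a S i \<le> weight a S l))"
  (is "_ \<longleftrightarrow> ?R")
proof -
  let ?f = "\<lambda>i. ereal (real_of_int (a i)) + ereal_of_enat (trop_val S i)"
  have fin: "?f i = ereal (of_int (weight a S i))" if ex: "\<exists>s\<in>S. i \<le> s" for i
  proof -
    obtain s where "s \<in> S" "i \<le> s" using ex by blast
    from trop_val_eq_nxt[OF this] nxt_ge[OF this] show ?thesis
      by (simp add: weight_def of_nat_diff)
  qed
  have inf: "?f i = \<infinity>" if "\<not> (\<exists>s\<in>S. i \<le> s)" for i
    using trop_val_eq_infinity[OF that] by simp
  show ?thesis
  proof
    assume "S \<in> Sol k a"
    then obtain i j where ne: "S \<noteq> {}" and ij: "i < j" "j \<le> k" "?f i = ?f j" "\<forall>l\<le>k. ?f i \<le> ?f l"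
      unfolding Sol_def attained_twice_iff by auto
    have ex0: "\<exists>s\<in>S. 0 \<le> s" using ne by auto
    have "?f j \<le> ?f 0" using ij(3,4) by (metis le0)
    then have "?f j \<noteq> \<infinity>" unfolding fin[OF ex0] by (metis ereal_infty_less_eq(1) PInfty_neq_ereal(1))
    then have exj: "\<exists>s\<in>S. j \<le> s" using inf by blast
    then have exi: "\<exists>s\<in>S. i \<le> s" using ij(1) by (meson less_imp_le order_trans)
    show ?R
    proof (intro exI conjI)
      show "weight a S i = weight a S j" using ij(3) unfolding fin[OF exi] fin[OF exj] by simp
      show "\<forall>l\<le>k. (\<exists>s\<in>S. l \<le> s) \<longrightarrow> weight a S i \<le> weight a S l"
      proof (intro allI impI)
        fix l assume "l \<le> k" "\<exists>s\<in>S. l \<le> s"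
        then show "weight a S i \<le> weight a S l"
          using ij(4)[rule_format, of l] fin[OF exi] fin[of l] by simp
      qed
    qed (use ij exj in auto)
  next
    assume ?R
    then obtain i j where ij: "i < j" "j \<le> k" "weight a S i = weight a S j"
      and exj: "\<exists>s\<in>S. j \<le> s"
      and mn: "\<And>l. l \<le> k \<Longrightarrow> \<exists>s\<in>S. l \<le> s \<Longrightarrow> weight a S i \<le> weight a S l" by blast
    have exi: "\<exists>s\<in>S. i \<le> s" using exj ij(1) by (meson less_imp_le order_trans)
    have "?f i \<le> ?f l" if "l \<le> k" for l
      using inf[of l] fin[of l] fin[OF exi] mn[OF that] by (cases "\<exists>s\<in>S. l \<le> s") auto
    moreover have "?f i = ?f j" using fin[OF exi] fin[OF exj] ij(3) by simp
    ultimately show "S \<in> Sol k a"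
      unfolding Sol_def attained_twice_iff using ij exj by blast
  qed
qed

text \<open>
  Passing from \<open>S\<close> to the subset \<open>{nxt S i, nxt S j}\<close> keeps the terms at \<open>i\<close> and \<open>j\<close> and can only
  increase the other ones.
\<close>

lemma solution_pair:
  assumes "S \<in> Sol k a"
  obtains i j where "i < j" "j \<le> k" "\<exists>s\<in>S. j \<le> s" "weight a S i = weight a S j"
    "{nxt S i, nxt S j} \<in> Sol k a"
proof -
  obtain i j where ij: "i < j" "j \<le> k" "\<exists>s\<in>S. j \<le> s" "weight a S i = weight a S j"
    and mn: "\<forall>l\<le>k. (\<exists>s\<in>S. l \<le> s) \<longrightarrow> weight a S i \<le> weight a S l"
    using assms unfolding Sol_iff by blast
  obtain s where s: "s \<in> S" "j \<le> s" using ij(3) by auto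
  then have si: "i \<le> s" using ij(1) by auto
  let ?T = "{nxt S i, nxt S j}"
  have sub: "?T \<subseteq> S" using nxt_in[OF s] nxt_in[OF s(1) si] by simp
  have Ti: "nxt ?T i = nxt S i"
    using nxt_ge[OF s(1) si] nxt_le[of _ S i] sub by (intro nxt_eqI) auto
  have Tj: "nxt ?T j = nxt S j"
    using nxt_ge[OF s] nxt_le[of _ S j] sub by (intro nxt_eqI) auto
  have "weight a ?T i \<le> weight a ?T l" if l: "l \<le> k" "\<exists>t\<in>?T. l \<le> t" for l
  proof -
    obtain t where t: "t \<in> ?T" "l \<le> t" using l(2) by blast
    have "nxt S l \<le> nxt ?T l"
      using nxt_in[OF t] nxt_ge[OF t] sub by (intro nxt_le) auto
    moreover have "weight a S i \<le> weight a S l" using mn l(1) t sub by blast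
    ultimately show ?thesis unfolding weight_def Ti by simp
  qed
  moreover have "weight a ?T i = weight a ?T j" using ij(4) unfolding weight_def Ti Tj .
  moreover have "\<exists>t\<in>?T. j \<le> t" using nxt_ge[OF s] by auto
  ultimately have "?T \<in> Sol k a" unfolding Sol_iff using ij(1,2) by blast
  then show thesis using that ij by blast
qed

lemma singleton_in_Sol_iff:
  assumes "k \<le> q"
  shows "{q} \<in> Sol k a \<longleftrightarrow> {k} \<in> Sol k a"
proof -
  have "nxt {s} l = s" if "l \<le> s" for s l using that by (intro nxt_eqI) auto
  then have w: "weight a {s} l = a l - int l + int s" if "k \<le> s" "l \<le> k" for s l
    using that unfolding weight_def by simp
  have "{s} \<in> Sol k a \<longleftrightarrow>
      (\<exists>i j. i < j \<and> j \<le> k \<and> a i - int i = a j - int j \<and> (\<forall>l\<le>k. a i - int i \<le> a l - int l))"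
    if "k \<le> s" for s
    unfolding Sol_iff using that w[OF that] by (intro iff_exI) (auto dest: order_trans)
  then show ?thesis using assms by simp
qed

lemma Sing_iff: "x \<in> Sing k e \<longleftrightarrow> {k} \<in> Sol k (\<lambda>i. x $ e i)"
proof -
  have "nxt {k} l = k" if "l \<le> k" for l using that by (intro nxt_eqI) auto
  then have "weight (\<lambda>i. x $ e i) {k} l = x $ e l + int k - int l" if "l \<le> k" for l
    using that unfolding weight_def by simp
  then show ?thesis
    unfolding Sing_def Sol_iff attained_twice_iff mem_Collect_eq by (intro iff_exI) auto
qed

text \<open>
  The bound behind holonomicity: the equality of the two minimal terms determines \<open>t\<close> when it
  is large.
\<close>

lemma minimal_sets_eq_pair:
  assumes "S \<in> minimal_sets (Sol k a)" "{k} \<notin> Sol k a"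
  shows "\<exists>s t i j. S = {s, t} \<and> s < k \<and> i \<le> k \<and> j \<le> k \<and>
    (t \<le> k \<or> int t = a i - int i + int s - (a j - int j))"
proof -
  have S: "S \<in> Sol k a" and mn: "\<And>T. T \<in> Sol k a \<Longrightarrow> T \<subseteq> S \<Longrightarrow> T = S"
    using assms(1) unfolding minimal_sets_def by auto
  obtain i j where ij: "i < j" "j \<le> k" "\<exists>s\<in>S. j \<le> s" "weight a S i = weight a S j"
    "{nxt S i, nxt S j} \<in> Sol k a"
    using solution_pair[OF S] .
  obtain s where s: "s \<in> S" "j \<le> s" using ij(3) by auto
  then have si: "i \<le> s" using ij(1) by auto
  have eq: "{nxt S i, nxt S j} = S"
    using nxt_in[OF s] nxt_in[OF s(1) si] by (intro mn ij(5)) simp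
  have le: "nxt S i \<le> nxt S j"
    using nxt_in[OF s] nxt_ge[OF s] ij(1) by (intro nxt_le) auto
  have "nxt S i < k"
  proof (rule ccontr)
    assume "\<not> nxt S i < k"
    then have ge: "k \<le> nxt S i" by simp
    \<comment> \<open>Then \<open>S\<close> is a singleton \<open>{q}\<close> with \<open>q \<ge> k\<close>.\<close>
    have "nxt S l = nxt S i" if "l \<le> k" for l
    proof (rule nxt_eqI)
      show "nxt S i \<in> S" using eq by blast
      show "l \<le> nxt S i" using that ge by simp
      fix t assume "t \<in> S"
      then have "t \<in> {nxt S i, nxt S j}" using eq by simp
      then show "nxt S i \<le> t" using le by auto
    qed
    then have "S = {nxt S i}" using eq ij(2) by auto
    then show False using singleton_in_Sol_iff[OF ge] S assms(2) by metis
  qed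
  moreover have "int (nxt S j) = a i - int i + int (nxt S i) - (a j - int j)"
    using ij(4) unfolding weight_def by simp
  ultimately show ?thesis using eq ij(1,2)
    by (intro exI[of _ "nxt S i"] exI[of _ "nxt S j"] exI[of _ i] exI[of _ j]) auto
qed

lemma holonomic_iff: "holonomic k a \<longleftrightarrow> {k} \<notin> Sol k a"
proof
  assume hol: "holonomic k a"
  show "{k} \<notin> Sol k a"
  proof
    assume k: "{k} \<in> Sol k a"
    have "{q} \<in> minimal_sets (Sol k a)" if "k \<le> q" for q
    proof -
      have "{} \<notin> Sol k a" by (simp add: Sol_def)
      then show ?thesis
        using singleton_in_Sol_iff[OF that] k unfolding minimal_sets_def
        by (auto simp: subset_singleton_iff)
    qed
    then have "(\<lambda>q. {q}) ` {k..} \<subseteq> minimal_sets (Sol k a)" by auto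
    then have "finite ((\<lambda>q. {q}) ` {k..})" using hol finite_subset unfolding holonomic_def by blast
    then show False using infinite_Ici finite_imageD[of "\<lambda>q. {q}" "{k..}"] by (auto simp: inj_on_def)
  qed
next
  assume k: "{k} \<notin> Sol k a"
  define R where "R = {..k} \<union> (\<lambda>(i, j, s). nat (a i - int i + int s - (a j - int j))) `
    ({..k} \<times> {..k} \<times> {..k})"
  have "minimal_sets (Sol k a) \<subseteq> (\<lambda>(s, t). {s, t}) ` ({..k} \<times> R)"
  proof
    fix S assume "S \<in> minimal_sets (Sol k a)"
    from minimal_sets_eq_pair[OF this k] obtain s t i j where
      st: "S = {s, t}" "s < k" "i \<le> k" "j \<le> k" "t \<le> k \<or> int t = a i - int i + int s - (a j - int j)"
      by blast
    have "t \<in> R"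
    proof (cases "t \<le> k")
      case False
      then have "t = nat (a i - int i + int s - (a j - int j))" using st(5) by linarith
      then show ?thesis unfolding R_def using st(2-4) by (intro UnI2 image_eqI[of _ _ "(i, j, s)"]) auto
    qed (simp add: R_def)
    then show "S \<in> (\<lambda>(s, t). {s, t}) ` ({..k} \<times> R)" using st(1,2) by (intro image_eqI[of _ _ "(s, t)"]) auto
  qed
  moreover have "finite R" unfolding R_def by simp
  ultimately show "holonomic k a"
    unfolding holonomic_def by (meson finite_SigmaI finite_atMost finite_imageI finite_subset)
qed

text \<open>
  For \<open>q \<ge> k\<close> the terms of \<open>{p, q}\<close> are \<open>a i - i + p\<close> for \<open>i \<le> p\<close> and \<open>a i - i + q\<close> for
  \<open>p < i \<le> k\<close>. Let \<open>A\<close> and \<open>B\<close> be the respective minima of \<open>a i - i\<close>. If \<open>{p}\<close> is not a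
  solution, then the minimum over \<open>i \<le> p\<close> is attained once, so a suitable \<open>q\<close> exists iff
  \<open>B + k \<le> A + p\<close>, and then \<open>q = A + p - B\<close> makes the two minima equal. The right-hand side
  below spells this out as comparisons of coefficients.
\<close>

lemma star_iff:
  assumes p: "p < k" and ns: "{k} \<notin> Sol k a"
  shows "(\<exists>q\<ge>k. {p, q} \<in> minimal_sets (Sol k a)) \<longleftrightarrow>
    {p} \<notin> Sol k a \<and>
    (\<exists>j\<in>{p<..k}. \<forall>i\<le>p. int k - int p + int i - int j \<le> a i - a j)"
    (is "?L \<longleftrightarrow> _ \<and> ?R")
proof -
  have nxtp: "nxt {p} l = p" if "l \<le> p" for l using that by (intro nxt_eqI) auto
  have nlow: "nxt {p, q} l = p" if "l \<le> p" "k \<le> q" for l q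
    using that p by (intro nxt_eqI) auto
  have nhigh: "nxt {p, q} l = q" if "p < l" "l \<le> k" "k \<le> q" for l q
    using that p by (intro nxt_eqI) auto
  \<comment> \<open>Outside \<open>Sing\<close> the set \<open>{q}\<close> is not a solution, so only \<open>{p}\<close> can violate minimality.\<close>
  have min_iff: "{p, q} \<in> minimal_sets (Sol k a) \<longleftrightarrow> {p} \<notin> Sol k a \<and> {p, q} \<in> Sol k a" if "k \<le> q" for q
  proof -
    have "{q} \<notin> Sol k a" "{} \<notin> Sol k a"
      using singleton_in_Sol_iff[OF that] ns by (auto simp: Sol_def)
    moreover have "p \<noteq> q" using that p by simp
    moreover have "T \<subseteq> {p, q} \<longleftrightarrow> T = {} \<or> T = {p} \<or> T = {q} \<or> T = {p, q}" for T by blast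
    ultimately show ?thesis unfolding minimal_sets_def by auto
  qed
  define A where "A = Min ((\<lambda>i. a i - int i) ` {..p})"
  define B where "B = Min ((\<lambda>i. a i - int i) ` {p<..k})"
  have Ale: "A \<le> a i - int i" if "i \<le> p" for i unfolding A_def using that by simp
  have Ble: "B \<le> a i - int i" if "p < i" "i \<le> k" for i unfolding B_def using that by simp
  have "A \<in> (\<lambda>i. a i - int i) ` {..p}" unfolding A_def by (intro Min_in) auto
  then obtain iA where iA: "iA \<le> p" "A = a iA - int iA" by auto
  have "B \<in> (\<lambda>i. a i - int i) ` {p<..k}" unfolding B_def using p by (intro Min_in) auto
  then obtain iB where iB: "p < iB" "iB \<le> k" "B = a iB - int iB" by auto
  have R_iff: "?R \<longleftrightarrow> B + int k \<le> A + int p"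
  proof
    assume ?R
    then obtain j where "p < j" "j \<le> k" "int k - int p + int iA - int j \<le> a iA - a j"
      using iA(1) by auto
    then show "B + int k \<le> A + int p" using Ble[of j] iA(2) by linarith
  next
    assume "B + int k \<le> A + int p"
    then have "\<forall>i\<le>p. int k - int p + int i - int iB \<le> a i - a iB" using Ale iB(3) by (smt (verit))
    then show ?R using iB by auto
  qed
  have ex: "\<exists>s\<in>{p, q}. l \<le> s" if "l \<le> k" "k \<le> q" for l q using that by auto
  have wlow: "weight a {p, q} l = a l - int l + int p" if "l \<le> p" "k \<le> q" for l q
    using nlow[OF that] by (simp add: weight_def)
  have whigh: "weight a {p, q} l = a l - int l + int q" if "p < l" "l \<le> k" "k \<le> q" for l q
    using nhigh[OF that] by (simp add: weight_def)
  show ?thesis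
  proof (cases "{p} \<in> Sol k a")
    case True
    then show ?thesis using min_iff by blast
  next
    case False
    have "(\<exists>q\<ge>k. {p, q} \<in> Sol k a) \<longleftrightarrow> B + int k \<le> A + int p"
    proof
      assume "\<exists>q\<ge>k. {p, q} \<in> Sol k a"
      then obtain q where q: "k \<le> q" "{p, q} \<in> Sol k a" by blast
      then obtain i j where ij: "i < j" "j \<le> k" "weight a {p, q} i = weight a {p, q} j"
        and mn: "\<And>l. l \<le> k \<Longrightarrow> weight a {p, q} i \<le> weight a {p, q} l"
        unfolding Sol_iff using ex[OF _ q(1)] by blast
      \<comment> \<open>If both minimal positions were at most \<open>p\<close>, then \<open>{p}\<close> would be a solution.\<close>
      have "p < j"
      proof (rule ccontr)
        assume "\<not> p < j"
        then have "j \<le> p" by simp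
        have w: "weight a {p} l = weight a {p, q} l" if "l \<le> p" for l
          using wlow[OF that q(1)] nxtp[OF that] by (simp add: weight_def)
        have "{p} \<in> Sol k a" unfolding Sol_iff
          using ij \<open>j \<le> p\<close> mn p by (intro exI[of _ i] exI[of _ j]) (auto simp: w)
        with False show False by simp
      qed
      then have "weight a {p, q} iA \<ge> a j - int j + int q"
        using mn[of iA] ij whigh[of j q] q(1) iA(1) p by simp
      then have "A + int p \<ge> a j - int j + int q" using wlow[OF iA(1) q(1)] iA(2) by simp
      then show "B + int k \<le> A + int p" using Ble[of j] \<open>p < j\<close> ij(2) q(1) by linarith
    next
      assume le: "B + int k \<le> A + int p"
      define q where "q = nat (A + int p - B)"
      have q: "k \<le> q" "A + int p = B + int q" using le unfolding q_def by linarith+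
      have "weight a {p, q} iA = A + int p" using wlow[OF iA(1) q(1)] iA(2) by simp
      moreover have "weight a {p, q} iB = A + int p" using whigh[OF iB(1,2) q(1)] iB(3) q(2) by simp
      moreover have "A + int p \<le> weight a {p, q} l" if "l \<le> k" for l
        using wlow[of l q] whigh[of l q] q Ale[of l] Ble[of l] that by (cases "l \<le> p") auto
      moreover have "iA < iB" "\<exists>s\<in>{p, q}. iB \<le> s" using iA(1) iB(1,2) q(1) by auto
      ultimately have "{p, q} \<in> Sol k a"
        unfolding Sol_iff using iB(2) by metis
      then show "\<exists>q\<ge>k. {p, q} \<in> Sol k a" using q(1) by blast
    qed
    then show ?thesis using False min_iff R_iff by auto
  qed
qed


section \<open>Polyhedra given by difference constraints\<close>

text \<open>
  The triple \<open>(j, l, c)\<close> stands for the constraint \<open>x(j) - x(l) \<ge> c\<close>. An equation is encoded by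
  the two triples \<open>(j, l, c)\<close> and \<open>(l, j, -c)\<close>.
\<close>

definition diff_polyhedron :: "(nat \<Rightarrow> 'n::finite) \<Rightarrow> (nat \<times> nat \<times> int) set \<Rightarrow> (real ^ 'n) set" where
  "diff_polyhedron e T = {x. \<forall>(j, l, c)\<in>T. of_int c \<le> x $ e j - x $ e l}"

lemma diff_polyhedron_eq_Inter:
  "diff_polyhedron e T = \<Inter>((\<lambda>(j, l, c). {x. x $ e j - x $ e l \<ge> of_int c}) ` T)"
  unfolding diff_polyhedron_def by auto

lemma given_by_difference_constraints_diff_polyhedron:
  assumes "finite T" "T \<subseteq> {..k} \<times> {..k} \<times> UNIV"
  shows "given_by_difference_constraints k (e :: nat \<Rightarrow> 'n::finite) (diff_polyhedron e T)"
  unfolding given_by_difference_constraints_def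
proof (intro exI conjI)
  show "\<forall>H\<in>(\<lambda>(j, l, c). {x. x $ e j - x $ e l \<ge> of_int c}) ` T. difference_constraint k e H"
  proof
    fix H :: "(real ^ 'n) set" assume "H \<in> (\<lambda>(j, l, c). {x. x $ e j - x $ e l \<ge> of_int c}) ` T"
    then obtain j l c where "(j, l, c) \<in> T" "H = {x. x $ e j - x $ e l \<ge> of_int c}" by auto
    moreover from this have "j \<le> k" "l \<le> k" using assms(2) by auto
    ultimately show "difference_constraint k e H" unfolding difference_constraint_def by blast
  qed
qed (use assms(1) diff_polyhedron_eq_Inter in auto)

lemma given_by_difference_constraints_empty: "given_by_difference_constraints k e {}"
proof -
  have "given_by_difference_constraints k e (diff_polyhedron e {(0, 0, 1)})"
    by (rule given_by_difference_constraints_diff_polyhedron) auto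
  moreover have "diff_polyhedron e {(0, 0, 1)} = {}" by (simp add: diff_polyhedron_def)
  ultimately show ?thesis by simp
qed

lemma polyhedron_diff_polyhedron:
  assumes "finite T"
  shows "polyhedron (diff_polyhedron (e :: nat \<Rightarrow> 'n::finite) T)"
proof -
  have "{x :: real ^ 'n. x $ e j - x $ e l \<ge> of_int c} = {x. (axis (e j) 1 - axis (e l) 1) \<bullet> x \<ge> (of_int c :: real)}" for j l c
    by (simp add: inner_diff_left inner_axis' inner_real_def)
  then have "polyhedron {x :: real ^ 'n. x $ e j - x $ e l \<ge> (of_int c :: real)}" for j l c
    by (simp add: polyhedron_halfspace_ge)
  then show ?thesis
    unfolding diff_polyhedron_eq_Inter using assms by (intro polyhedron_Inter) auto
qed

text \<open>
  A nonempty face is obtained by turning into equations the constraints that are tight at one of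
  its relative interior points \<open>x0\<close>. From \<open>x0\<close> one can move within the face beyond \<open>x0\<close>, away
  from any other point of the face, so a constraint tight at \<open>x0\<close> is tight on the whole face.
  Conversely, if \<open>y\<close> satisfies those equations, one can move a little from \<open>x0\<close> away from \<open>y\<close>
  inside the polyhedron, so \<open>x0\<close> lies in an open segment ending at \<open>y\<close>, and \<open>y\<close> is in the face.
\<close>

lemma face_of_diff_polyhedron:
  assumes fin: "finite T" and face: "F face_of diff_polyhedron e T" and x0: "x0 \<in> rel_interior F"
  shows "F = diff_polyhedron e (T \<union> {(l, j, - c) | j l c. (j, l, c) \<in> T \<and> x0 $ e j - x0 $ e l = of_int c})"
    (is "F = diff_polyhedron e (T \<union> ?R)")
proof
  let ?P = "diff_polyhedron e T"
  have conv: "convex F" and sub: "F \<subseteq> ?P" and x0F: "x0 \<in> F"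
    using face x0 face_of_imp_convex face_of_imp_subset rel_interior_subset by blast+
  have PD: "of_int c \<le> x $ e j - x $ e l" if "x \<in> ?P" "(j, l, c) \<in> T" for x j l c
    using that unfolding diff_polyhedron_def by auto
  show "F \<subseteq> diff_polyhedron e (T \<union> ?R)"
  proof
    fix y assume y: "y \<in> F"
    obtain t where t: "t > 1" "(1 - t) *\<^sub>R y + t *\<^sub>R x0 \<in> F"
      using convex_rel_interior_iff[OF conv] x0 x0F y by blast
    have "y $ e j - y $ e l \<le> of_int c" if h: "(j, l, c) \<in> T" "x0 $ e j - x0 $ e l = of_int c" for j l c
    proof -
      have "of_int c \<le> (1 - t) * (y $ e j - y $ e l) + t * (x0 $ e j - x0 $ e l)"
        using PD[OF subsetD[OF sub t(2)] h(1)] by (simp add: algebra_simps)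
      then have "(t - 1) * (y $ e j - y $ e l) \<le> (t - 1) * of_int c"
        unfolding h(2) by (simp add: algebra_simps)
      then show ?thesis using t(1) by simp
    qed
    then have "of_int (- c) \<le> y $ e l - y $ e j" if "(j, l, c) \<in> T" "x0 $ e j - x0 $ e l = of_int c" for j l c
      using that by fastforce
    moreover have "y \<in> ?P" using y sub by blast
    ultimately show "y \<in> diff_polyhedron e (T \<union> ?R)" unfolding diff_polyhedron_def by blast
  qed
  show "diff_polyhedron e (T \<union> ?R) \<subseteq> F"
  proof
    fix y assume y: "y \<in> diff_polyhedron e (T \<union> ?R)"
    then have yP: "y \<in> ?P" unfolding diff_polyhedron_def by auto
    have tight: "y $ e j - y $ e l = of_int c" if "(j, l, c) \<in> T" "x0 $ e j - x0 $ e l = of_int c" for j l c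
    proof -
      have "(l, j, - c) \<in> ?R" using that by blast
      then have "of_int (- c) \<le> y $ e l - y $ e j" using y unfolding diff_polyhedron_def by blast
      then show ?thesis using PD[OF yP that(1)] by simp
    qed
    have "\<forall>\<^sub>F r in at_right 0. \<forall>h\<in>T. case h of (j, l, c) \<Rightarrow>
        of_int c \<le> (x0 + r *\<^sub>R (x0 - y)) $ e j - (x0 + r *\<^sub>R (x0 - y)) $ e l"
    proof (rule eventually_ball_finite[OF fin], rule ballI)
      fix h assume h: "h \<in> T"
      obtain j l c where jlc: "h = (j, l, c)" by (cases h)
      have T: "(j, l, c) \<in> T" using h jlc by simp
      let ?g = "\<lambda>r. (x0 + r *\<^sub>R (x0 - y)) $ e j - (x0 + r *\<^sub>R (x0 - y)) $ e l"
      have g: "?g r = (x0 $ e j - x0 $ e l) + r * ((x0 $ e j - x0 $ e l) - (y $ e j - y $ e l))" for r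
        by (simp add: algebra_simps)
      have "\<forall>\<^sub>F r in at_right 0. of_int c \<le> ?g r"
      proof (cases "x0 $ e j - x0 $ e l = of_int c")
        case True
        then show ?thesis unfolding g tight[OF T True] by simp
      next
        case False
        then have "of_int c < x0 $ e j - x0 $ e l" using PD[OF subsetD[OF sub x0F] T] by simp
        moreover have "(?g \<longlongrightarrow> (x0 $ e j - x0 $ e l) + 0 * ((x0 $ e j - x0 $ e l) - (y $ e j - y $ e l))) (at_right 0)"
          unfolding g by (intro tendsto_intros)
        ultimately have "\<forall>\<^sub>F r in at_right 0. of_int c < ?g r" by (intro order_tendstoD) auto
        then show ?thesis by eventually_elim simp
      qed
      then show "\<forall>\<^sub>F r in at_right 0. case h of (j, l, c) \<Rightarrow>
        of_int c \<le> (x0 + r *\<^sub>R (x0 - y)) $ e j - (x0 + r *\<^sub>R (x0 - y)) $ e l"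
        unfolding jlc by simp
    qed
    moreover have "\<forall>\<^sub>F r in at_right (0::real). 0 < r" by (rule eventually_at_right_less)
    ultimately have "\<forall>\<^sub>F r in at_right 0. 0 < r \<and> x0 + r *\<^sub>R (x0 - y) \<in> ?P"
      unfolding diff_polyhedron_def by eventually_elim simp
    then obtain r where r: "0 < r" "x0 + r *\<^sub>R (x0 - y) \<in> ?P"
      using eventually_happens'[OF trivial_limit_at_right_real] by blast
    show "y \<in> F"
    proof (cases "y = x0")
      case False
      define z where "z = x0 + r *\<^sub>R (x0 - y)"
      have zy: "z - y = (1 + r) *\<^sub>R (x0 - y)" unfolding z_def by (simp add: algebra_simps)
      have "x0 = y + (1 / (1 + r)) *\<^sub>R (z - y)" unfolding zy using r(1) by simp
      then have "x0 = (1 - 1 / (1 + r)) *\<^sub>R y + (1 / (1 + r)) *\<^sub>R z" by (simp add: algebra_simps)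
      moreover have "0 < 1 / (1 + r)" "1 / (1 + r) < 1" using r(1) by auto
      moreover have "y \<noteq> z" using zy False r(1) by auto
      ultimately have "x0 \<in> open_segment y z" unfolding in_segment by blast
      then show ?thesis using face_ofD[OF face] yP r(2) x0F unfolding z_def by blast
    qed (simp add: x0F)
  qed
qed

lemma face_of_diff_polyhedron_given:
  assumes "finite T" "T \<subseteq> {..k} \<times> {..k} \<times> UNIV" "F face_of diff_polyhedron e T"
  shows "given_by_difference_constraints k e F"
proof (cases "F = {}")
  case True
  then show ?thesis by (simp add: given_by_difference_constraints_empty)
next
  case False
  have "convex F" using assms(3) by (rule face_of_imp_convex)
  then obtain x0 where x0: "x0 \<in> rel_interior F" using False rel_interior_eq_empty by blast
  let ?R = "{(l, j, - c) | j l c. (j, l, c) \<in> T \<and> x0 $ e j - x0 $ e l = of_int c}"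
  have "?R \<subseteq> (\<lambda>(j, l, c). (l, j, - c)) ` T" by force
  then have "finite (T \<union> ?R)" using assms(1) finite_subset by blast
  moreover have "T \<union> ?R \<subseteq> {..k} \<times> {..k} \<times> UNIV" using assms(2) by auto
  ultimately show ?thesis
    unfolding face_of_diff_polyhedron[OF assms(1,3) x0]
    by (rule given_by_difference_constraints_diff_polyhedron)
qed

text \<open>Faces of different members of \<open>\<P>\<close> are disjoint, so no intersection condition arises between them.\<close>

lemma polyhedral_complex_faces:
  assumes "finite \<P>" "\<And>P. P \<in> \<P> \<Longrightarrow> polyhedron P" "pairwise disjnt \<P>"
  shows "polyhedral_complex {F. \<exists>P\<in>\<P>. F face_of P}"
  unfolding polyhedral_complex_def
proof (intro conjI ballI allI impI)
  have "{F. \<exists>P\<in>\<P>. F face_of P} = (\<Union>P\<in>\<P>. {F. F face_of P})" by auto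
  then show "finite {F. \<exists>P\<in>\<P>. F face_of P}"
    using assms(1,2) finite_polyhedron_faces by auto
next
  fix F assume "F \<in> {F. \<exists>P\<in>\<P>. F face_of P}"
  then show "polyhedron F" using assms(2) face_of_polyhedron_polyhedron by blast
next
  fix F G assume "F \<in> {F. \<exists>P\<in>\<P>. F face_of P}" "G face_of F"
  then show "G \<in> {F. \<exists>P\<in>\<P>. F face_of P}" using face_of_trans by blast
next
  have "(F \<inter> G) face_of F" if "F face_of P" "G face_of Q" "P \<in> \<P>" "Q \<in> \<P>" for F G P Q
  proof (cases "P = Q")
    case True
    have "F \<inter> G face_of P" using that(1,2) True by (simp add: face_of_Int)
    then show ?thesis using that(1) by (metis face_of_subset face_of_imp_subset inf_le1)
  next
    case False
    then have "P \<inter> Q = {}" using assms(3) that(3,4) by (auto simp: pairwise_def disjnt_def)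
    then have "F \<inter> G = {}" using that(1,2) face_of_imp_subset by blast
    then show ?thesis by simp
  qed
  then have Int: "(F \<inter> G) face_of F" if "F \<in> {F. \<exists>P\<in>\<P>. F face_of P}" "G \<in> {F. \<exists>P\<in>\<P>. F face_of P}" for F G
    using that by blast
  fix F G assume FG: "F \<in> {F. \<exists>P\<in>\<P>. F face_of P}" "G \<in> {F. \<exists>P\<in>\<P>. F face_of P}"
  show "F \<inter> G face_of F" by (rule Int[OF FG])
  show "F \<inter> G face_of G" using Int[OF FG(2,1)] by (simp add: Int_commute)
qed


section \<open>Invariance under equality of truncated differences\<close>

text \<open>The integer of the interval \<open>[-N, N]\<close> closest to \<open>d\<close>, for \<open>N \<ge> 0\<close>.\<close>

definition truncate :: "int \<Rightarrow> int \<Rightarrow> int" where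
  "truncate N d = max (- N) (min N d)"

text \<open>The points \<open>a\<close> and \<open>b\<close> have the same differences of coordinates after truncation to \<open>[-N, N]\<close>.\<close>

definition same_truncated :: "int \<Rightarrow> nat \<Rightarrow> (nat \<Rightarrow> int) \<Rightarrow> (nat \<Rightarrow> int) \<Rightarrow> bool" where
  "same_truncated N k a b \<longleftrightarrow> (\<forall>j\<le>k. \<forall>l\<le>k. truncate N (a j - a l) = truncate N (b j - b l))"

lemma same_truncated_le_iff:
  assumes "same_truncated N k a b" "j \<le> k" "l \<le> k" "- N \<le> c" "c < N"
  shows "a j - a l \<le> c \<longleftrightarrow> b j - b l \<le> c"
proof -
  have "d \<le> c \<longleftrightarrow> truncate N d \<le> c" for d using assms(4,5) unfolding truncate_def by auto
  then show ?thesis using assms(1-3) unfolding same_truncated_def by metis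
qed

text \<open>
  Comparing the terms at \<open>i\<close> and \<open>l\<close> means comparing \<open>a i - a l\<close> with
  \<open>(i - l) + (nxt T l - nxt T i)\<close>, where both summands lie in \<open>[-k, k]\<close>.
\<close>

lemma Sol_cong:
  assumes sim: "same_truncated N k a b" and N: "2 * int k < N" and T: "T \<subseteq> {..k}"
  shows "T \<in> Sol k a \<longleftrightarrow> T \<in> Sol k b"
proof -
  have nk: "nxt T i \<le> k" if "\<exists>s\<in>T. i \<le> s" for i using that nxt_in T by blast
  have le: "weight a T i \<le> weight a T l \<longleftrightarrow> weight b T i \<le> weight b T l"
    if "\<exists>s\<in>T. i \<le> s" "\<exists>s\<in>T. l \<le> s" for i l
  proof -
    let ?c = "int i - int l + int (nxt T l) - int (nxt T i)"
    have ik: "i \<le> k" "l \<le> k" using that T by (auto dest: order_trans)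
    have "weight x T i \<le> weight x T l \<longleftrightarrow> x i - x l \<le> ?c" for x
      unfolding weight_def by auto
    moreover have "- N \<le> ?c" "?c < N" using N ik nk[OF that(1)] nk[OF that(2)] by linarith+
    ultimately show ?thesis using same_truncated_le_iff[OF sim ik] by blast
  qed
  have eq: "weight a T i = weight a T l \<longleftrightarrow> weight b T i = weight b T l"
    if "\<exists>s\<in>T. i \<le> s" "\<exists>s\<in>T. l \<le> s" for i l
    using le[OF that] le[OF that(2,1)] by (metis antisym order_refl)
  show ?thesis unfolding Sol_iff
  proof (intro iff_exI conj_cong refl)
    fix i j :: nat assume "i < j" and j: "\<exists>s\<in>T. j \<le> s"
    then have i: "\<exists>s\<in>T. i \<le> s" by (meson less_imp_le order_trans)
    show "weight a T i = weight a T j \<longleftrightarrow> weight b T i = weight b T j" by (rule eq[OF i j])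
    show "(\<forall>l\<le>k. (\<exists>s\<in>T. l \<le> s) \<longrightarrow> weight a T i \<le> weight a T l) \<longleftrightarrow>
      (\<forall>l\<le>k. (\<exists>s\<in>T. l \<le> s) \<longrightarrow> weight b T i \<le> weight b T l)"
      using le[OF i] by blast
  qed
qed

lemma minimal_sets_Sol_cong:
  assumes "same_truncated N k a b" "2 * int k < N" "T \<subseteq> {..k}"
  shows "T \<in> minimal_sets (Sol k a) \<longleftrightarrow> T \<in> minimal_sets (Sol k b)"
proof -
  have "S \<in> Sol k a \<longleftrightarrow> S \<in> Sol k b" if "S \<subseteq> T" for S
    using that assms(3) by (intro Sol_cong[OF assms(1,2)]) simp
  then show ?thesis unfolding minimal_sets_def by blast
qed

lemma U_cong:
  assumes sim: "same_truncated N k (\<lambda>i. x $ e i) (\<lambda>i. y $ e i)" and N: "2 * int k < N"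
  shows "x \<in> U k e C \<longleftrightarrow> y \<in> U k e C"
proof -
  let ?a = "\<lambda>i. x $ e i" and ?b = "\<lambda>i. y $ e i"
  note Sol = Sol_cong[OF sim N] and mins = minimal_sets_Sol_cong[OF sim N]
  have hol: "holonomic k ?a \<longleftrightarrow> holonomic k ?b"
    unfolding holonomic_iff using Sol[of "{k}"] by simp
  have low: "{j, l} \<in> minimal_sets (Sol k ?a) \<longleftrightarrow> {j, l} \<in> minimal_sets (Sol k ?b)"
    if "j \<le> l \<and> l < k" for j l using that by (intro mins) auto
  have star: "(\<exists>q\<ge>k. {p, q} \<in> minimal_sets (Sol k ?a)) \<longleftrightarrow> (\<exists>q\<ge>k. {p, q} \<in> minimal_sets (Sol k ?b))"
    if p: "p < k" and h: "holonomic k ?a" for p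
  proof -
    have "int k - int p + int i - int j \<le> ?a i - ?a j \<longleftrightarrow> int k - int p + int i - int j \<le> ?b i - ?b j"
      if "i \<le> p" "p < j" "j \<le> k" for i j
    proof -
      let ?c = "int k - int p + int i - int j - 1"
      have "- N \<le> ?c" "?c < N" "i \<le> k" using that N p by linarith+
      then have "?a i - ?a j \<le> ?c \<longleftrightarrow> ?b i - ?b j \<le> ?c"
        using same_truncated_le_iff[OF sim, of i j ?c] that(3) by blast
      then show ?thesis by linarith
    qed
    then have "(\<exists>j\<in>{p<..k}. \<forall>i\<le>p. int k - int p + int i - int j \<le> ?a i - ?a j) \<longleftrightarrow>
        (\<exists>j\<in>{p<..k}. \<forall>i\<le>p. int k - int p + int i - int j \<le> ?b i - ?b j)"
      by (intro bex_cong refl) auto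
    moreover have "{p} \<in> Sol k ?a \<longleftrightarrow> {p} \<in> Sol k ?b" using p by (intro Sol) auto
    moreover have "{k} \<notin> Sol k ?a" "{k} \<notin> Sol k ?b" using h hol unfolding holonomic_iff by auto
    ultimately show ?thesis using star_iff[OF p] by simp
  qed
  show ?thesis unfolding U_def has_configuration_def mem_Collect_eq
    using hol low star by (intro conj_cong refl) auto
qed

section \<open>The cells\<close>

text \<open>
  For a truncated difference \<open>d\<close> at \<open>(j, l)\<close> strictly between \<open>-N\<close> and \<open>N\<close>, both \<open>(j, l, d)\<close> and
  \<open>(l, j, -d)\<close> occur, which gives an equation (vacuous if \<open>j = l\<close>). For \<open>d = N\<close> only
  \<open>(j, l, N)\<close> occurs.
\<close>

definition cell_constraints :: "int \<Rightarrow> nat \<Rightarrow> (nat \<Rightarrow> int) \<Rightarrow> (nat \<times> nat \<times> int) set" where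
  "cell_constraints N k a =
    {(j, l, truncate N (a j - a l)) | j l. j \<le> k \<and> l \<le> k \<and> - N < truncate N (a j - a l)}"

text \<open>The polyhedron whose integer points are those with the same truncated differences as \<open>a\<close>.\<close>

definition cell :: "int \<Rightarrow> nat \<Rightarrow> (nat \<Rightarrow> 'n::finite) \<Rightarrow> (nat \<Rightarrow> int) \<Rightarrow> (real ^ 'n) set" where
  "cell N k e a = diff_polyhedron e (cell_constraints N k a)"

lemma cell_constraints_subset:
  assumes "0 \<le> N"
  shows "cell_constraints N k a \<subseteq> {..k} \<times> {..k} \<times> {- N..N}"
  using assms unfolding cell_constraints_def truncate_def by auto

lemma finite_cell_constraints: "0 \<le> N \<Longrightarrow> finite (cell_constraints N k a)"
  by (rule finite_subset[OF cell_constraints_subset]) auto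

lemma finite_range_cell:
  assumes "0 \<le> N"
  shows "finite (range (cell N k e))"
proof -
  have "range (cell N k e) \<subseteq> diff_polyhedron e ` Pow ({..k} \<times> {..k} \<times> {- N..N})"
    unfolding cell_def using cell_constraints_subset[OF assms] by blast
  then show ?thesis by (rule finite_subset) simp
qed

lemma of_int_in_cell:
  assumes "0 \<le> N"
  shows "(\<chi> i. real_of_int (x $ i)) \<in> cell N k e (\<lambda>i. x $ e i)"
proof -
  have "real_of_int (truncate N (x $ e j - x $ e l)) \<le> real_of_int (x $ e j - x $ e l)"
    if "- N < truncate N (x $ e j - x $ e l)" for j l
    unfolding of_int_le_iff using that assms unfolding truncate_def by linarith
  then show ?thesis
    unfolding cell_def diff_polyhedron_def cell_constraints_def by auto
qed

text \<open>
  The common point \<open>y\<close> may be non-integral: different truncated differences \<open>d < d'\<close> of \<open>a\<close> and \<open>b\<close> would force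
  both \<open>y(j) - y(l) \<le> d\<close> and \<open>y(j) - y(l) \<ge> d'\<close>.
\<close>

lemma same_truncated_if_cells_meet:
  assumes N: "0 < N" and y: "y \<in> cell N k e a" "y \<in> cell N k e b"
  shows "same_truncated N k a b"
proof -
  have D: "real_of_int (truncate N (a j - a l)) \<le> y $ e j - y $ e l"
    if "y \<in> cell N k e a" "j \<le> k" "l \<le> k" "- N < truncate N (a j - a l)" for a j l
    using that unfolding cell_def diff_polyhedron_def cell_constraints_def by auto
  have neg: "truncate N (a j - a l) = - truncate N (a l - a j)" for a :: "nat \<Rightarrow> int" and j l
    using N unfolding truncate_def by linarith
  have bounds: "- N \<le> truncate N d" "truncate N d \<le> N" for d using N unfolding truncate_def by linarith+
  have le: "truncate N (a j - a l) \<le> truncate N (b j - b l)"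
    if "y \<in> cell N k e a" "y \<in> cell N k e b" "j \<le> k" "l \<le> k" for a b j l
  proof (rule ccontr)
    assume less: "\<not> ?thesis"
    then have "real_of_int (truncate N (a j - a l)) \<le> y $ e j - y $ e l"
      using bounds[of "b j - b l"] that by (intro D) auto
    moreover have "real_of_int (truncate N (b l - b j)) \<le> y $ e l - y $ e j"
      using less bounds[of "a j - a l"] neg[of b j l] that by (intro D) auto
    ultimately have "real_of_int (truncate N (a j - a l)) \<le> real_of_int (truncate N (b j - b l))"
      unfolding neg[of b j l] by simp
    then show False using less by simp
  qed
  show ?thesis unfolding same_truncated_def using le y by (metis antisym)
qed

lemma cell_eq_if_same_truncated:
  assumes "same_truncated N k a b"
  shows "cell N k e a = cell N k e b"
proof -
  have "truncate N (a j - a l) = truncate N (b j - b l)" if "j \<le> k" "l \<le> k" for j l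
    using assms that unfolding same_truncated_def by blast
  then have "cell_constraints N k a = cell_constraints N k b"
    unfolding cell_constraints_def by (metis (no_types, lifting))
  then show ?thesis unfolding cell_def by simp
qed

lemma cells_disjoint:
  assumes "0 < N"
  shows "pairwise disjnt (range (cell N k e))"
proof (rule pairwiseI)
  fix P Q assume "P \<in> range (cell N k e)" "Q \<in> range (cell N k e)" and ne: "P \<noteq> Q"
  then obtain a b where ab: "P = cell N k e a" "Q = cell N k e b" by blast
  show "disjnt P Q"
  proof (rule ccontr)
    assume "\<not> disjnt P Q"
    then obtain y where "y \<in> P" "y \<in> Q" unfolding disjnt_iff by blast
    then have "same_truncated N k a b" using same_truncated_if_cells_meet[OF assms] ab by blast
    then show False using ne ab cell_eq_if_same_truncated by blast
  qed
qed

section \<open>The configuration consisting of all stars\<close>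

text \<open>
  The coordinates of this point are so far apart that no two finite terms of a set
  \<open>T \<subseteq> {0..k}\<close> are equal. As \<open>x(k)\<close> is much smaller than the other coordinates, every \<open>{p, q}\<close> with a suitable
  \<open>q \<ge> k\<close> is a minimal solution.
\<close>

lemma steep_in_U:
  assumes N: "2 * int k < N" and x: "\<And>i. i \<le> k \<Longrightarrow> x $ e i = N * (int k - int i)"
  shows "x \<in> U k e {Star i | i. i < k}"
proof -
  let ?a = "\<lambda>i. x $ e i"
  have none: "T \<notin> Sol k ?a" if T: "T \<subseteq> {..k}" for T
  proof
    assume "T \<in> Sol k ?a"
    then obtain i j where ij: "i < j" "j \<le> k" "\<exists>s\<in>T. j \<le> s" "weight ?a T i = weight ?a T j"
      unfolding Sol_iff by blast
    obtain s where s: "s \<in> T" "j \<le> s" using ij(3) by auto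
    have "nxt T i \<in> T" "nxt T j \<in> T" using nxt_in[OF s] nxt_in[of s T i] s ij(1) by auto
    then have le: "nxt T i \<le> k" "nxt T j \<le> k" using T by auto
    have "N * (int k - int i) - int i + int (nxt T i) = N * (int k - int j) - int j + int (nxt T j)"
      using ij(4) x[of i] x[of j] ij(1,2) unfolding weight_def by simp
    then have "N * (int j - int i) = int i - int j + int (nxt T j) - int (nxt T i)"
      by (simp add: algebra_simps)
    moreover have "N * 1 \<le> N * (int j - int i)" using ij(1) N by (intro mult_left_mono) auto
    ultimately show False using N le ij(1,2) by linarith
  qed
  have ns: "{k} \<notin> Sol k ?a" using none by simp
  have star: "\<exists>q\<ge>k. {p, q} \<in> minimal_sets (Sol k ?a)" if p: "p < k" for p
    unfolding star_iff[OF p ns]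
  proof (intro conjI bexI[of _ k] allI impI)
    show "{p} \<notin> Sol k ?a" using p by (intro none) auto
    fix i assume "i \<le> p"
    then have "N * 1 \<le> N * (int k - int i)" using p N by (intro mult_left_mono) auto
    moreover have "?a i = N * (int k - int i)" "?a k = 0" using x[of i] x[of k] \<open>i \<le> p\<close> p by auto
    ultimately show "int k - int p + int i - int k \<le> ?a i - ?a k" using N \<open>i \<le> p\<close> by linarith
  qed (use p in auto)
  have "{j, l} \<notin> minimal_sets (Sol k ?a)" if "j \<le> l" "l < k" for j l
    using none[of "{j, l}"] that unfolding minimal_sets_def by auto
  then show ?thesis
    unfolding U_def has_configuration_def holonomic_iff using ns star by auto
qed

text \<open>
  The cell contains the open set \<open>?W\<close> given by \<open>x(j) - x(l) > N\<close> for all \<open>j < l \<le> k\<close>, which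
  contains the point with coordinates \<open>(N + 1) (k - i)\<close>.
\<close>

lemma interior_steep_cell:
  fixes e :: "nat \<Rightarrow> 'n::finite"
  assumes N: "0 < N" and inj: "inj_on e {0..k}" and a: "\<And>i. i \<le> k \<Longrightarrow> a i = N * (int k - int i)"
  shows "interior (cell N k e a) \<noteq> {}"
proof -
  let ?W = "\<Inter>(j, l)\<in>{(j, l). j < l \<and> l \<le> k}. {x :: real ^ 'n. of_int N < x $ e j - x $ e l}"
  have fin: "finite {(j, l). j < l \<and> l \<le> k}"
    by (rule finite_subset[of _ "{..k} \<times> {..k}"]) auto
  have "open ?W"
    by (rule open_INT[OF fin]) (auto intro!: open_Collect_less continuous_intros)
  moreover have "?W \<subseteq> cell N k e a"
  proof
    fix x assume "x \<in> ?W"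
    then have x: "of_int N < x $ e j - x $ e l" if "j < l" "l \<le> k" for j l using that by auto
    have "real_of_int (truncate N (a j - a l)) \<le> x $ e j - x $ e l"
      if "j \<le> k" "l \<le> k" "- N < truncate N (a j - a l)" for j l
    proof -
      consider "j < l" | "j = l" | "l < j" by linarith
      then show ?thesis
      proof cases
        case 1
        have "truncate N (a j - a l) \<le> N" using N unfolding truncate_def by linarith
        then have "real_of_int (truncate N (a j - a l)) \<le> of_int N" by simp
        then show ?thesis using x[OF 1 that(2)] by linarith
      next
        case 2
        then show ?thesis using N by (simp add: truncate_def)
      next
        case 3
        have "a l - a j = N * (int j - int l)" using a that by (simp add: algebra_simps)
        moreover have "N * 1 \<le> N * (int j - int l)" using 3 N by (intro mult_left_mono) auto
        ultimately have "a j - a l \<le> - N" by linarith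
        then have "truncate N (a j - a l) = - N" using N unfolding truncate_def by linarith
        with that(3) show ?thesis by simp
      qed
    qed
    then show "x \<in> cell N k e a"
      unfolding cell_def diff_polyhedron_def cell_constraints_def by auto
  qed
  moreover have "(\<chi> v. of_int (N + 1) * (real k - real (inv_into {0..k} e v))) \<in> ?W" (is "?z \<in> _")
  proof -
    have z: "?z $ e i = of_int (N + 1) * (real k - real i)" if "i \<le> k" for i
      using inv_into_f_f[OF inj, of i] that by simp
    have "of_int N < ?z $ e j - ?z $ e l" if "j < l" "l \<le> k" for j l
    proof -
      have "of_int (N + 1) * 1 \<le> of_int (N + 1) * (real l - real j)"
        using that N by (intro mult_left_mono) auto
      also have "\<dots> = ?z $ e j - ?z $ e l" using z[of j] z[of l] that by (simp add: algebra_simps)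
      finally show ?thesis by simp
    qed
    then show ?thesis by auto
  qed
  ultimately show ?thesis using interior_maximal by blast
qed

section \<open>The partition and its polyhedral complexes\<close>

lemma has_configuration_unique:
  assumes "C \<in> configurations k" "D \<in> configurations k" "has_configuration k a C" "has_configuration k a D"
  shows "C = D"
proof -
  have "C \<subseteq> D"
    if C: "C \<in> configurations k" and has: "has_configuration k a C" "has_configuration k a D" for C D
  proof
    fix t assume t: "t \<in> C"
    then consider j l where "t = Low {j, l}" "j \<le> l \<and> l < k" | p where "t = Star p" "p < k"
      using C unfolding configurations_def by blast
    then show "t \<in> D"
    proof cases
      case 1
      with t has show ?thesis unfolding has_configuration_def by metis
    next
      case 2
      with t has show ?thesis unfolding has_configuration_def by metis
    qed
  qed
  from this[OF assms(1,3,4)] this[OF assms(2,4,3)] show ?thesis by (rule subset_antisym)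
qed

lemma ex_configuration: "\<exists>C\<in>configurations k. has_configuration k a C"
proof -
  let ?C = "{Low {j, l} | j l. j \<le> l \<and> l < k \<and> {j, l} \<in> minimal_sets (Sol k a)} \<union>
    {Star p | p. p < k \<and> (\<exists>q\<ge>k. {p, q} \<in> minimal_sets (Sol k a))}"
  have "has_configuration k a ?C" unfolding has_configuration_def
  proof (intro conjI allI impI)
    fix j l assume jl: "j \<le> l \<and> l < k"
    show "{j, l} \<in> minimal_sets (Sol k a) \<longleftrightarrow> Low {j, l} \<in> ?C"
    proof
      assume "{j, l} \<in> minimal_sets (Sol k a)"
      with jl show "Low {j, l} \<in> ?C" by blast
    next
      assume "Low {j, l} \<in> ?C"
      then obtain j' l' where "{j, l} = {j', l'}" "{j', l'} \<in> minimal_sets (Sol k a)" by auto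
      then show "{j, l} \<in> minimal_sets (Sol k a)" by simp
    qed
  qed auto
  moreover have "?C \<in> configurations k" unfolding configurations_def by blast
  ultimately show ?thesis by blast
qed

text \<open>
  All faces of the cells of the points of \<open>U k e C\<close>. It is empty when \<open>U k e C\<close> is empty.
  The bound \<open>2 k + 1\<close> is the least one allowed by \<open>U_cong\<close>.
\<close>

definition config_complex :: "nat \<Rightarrow> (nat \<Rightarrow> 'n::finite) \<Rightarrow> symb set \<Rightarrow> (real ^ 'n) set set" where
  "config_complex k e C =
    {F. \<exists>P\<in>(\<lambda>x. cell (2 * int k + 1) k e (\<lambda>i. x $ e i)) ` U k e C. F face_of P}"

lemma
  shows polyhedral_complex_config_complex: "polyhedral_complex (config_complex k e C)"
    and given_by_difference_constraints_config_complex: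
      "P \<in> config_complex k e C \<Longrightarrow> given_by_difference_constraints k e P"
    and U_eq_integer_points_config_complex: "U k e C = integer_points (\<Union>(config_complex k e C))"
proof -
  let ?N = "2 * int k + 1"
  let ?cell = "\<lambda>x. cell ?N k e (\<lambda>i. x $ e i)"
  have poly: "polyhedron (cell ?N k e a)" for a
    unfolding cell_def by (simp add: polyhedron_diff_polyhedron finite_cell_constraints)
  have sub: "?cell ` U k e C \<subseteq> range (cell ?N k e)" by auto
  show "polyhedral_complex (config_complex k e C)"
    unfolding config_complex_def
  proof (rule polyhedral_complex_faces)
    show "finite (?cell ` U k e C)" using finite_subset[OF sub finite_range_cell] by simp
    show "pairwise disjnt (?cell ` U k e C)" using pairwise_subset[OF cells_disjoint sub] by simp
  qed (use poly in auto)
  show "given_by_difference_constraints k e P" if P: "P \<in> config_complex k e C"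
  proof -
    obtain a where face: "P face_of diff_polyhedron e (cell_constraints ?N k a)"
      using P unfolding config_complex_def cell_def by blast
    have "cell_constraints ?N k a \<subseteq> {..k} \<times> {..k} \<times> UNIV" using cell_constraints_subset[of ?N k a] by auto
    then show ?thesis using face by (intro face_of_diff_polyhedron_given[OF finite_cell_constraints]) auto
  qed
  show "U k e C = integer_points (\<Union>(config_complex k e C))"
  proof (intro subset_antisym subsetI)
    fix x assume x: "x \<in> U k e C"
    have "?cell x face_of ?cell x" using poly by (simp add: face_of_refl polyhedron_imp_convex)
    then have "?cell x \<in> config_complex k e C" unfolding config_complex_def using x by blast
    then show "x \<in> integer_points (\<Union>(config_complex k e C))"
      unfolding integer_points_def using of_int_in_cell[of ?N x k e] by auto
  next
    fix y assume "y \<in> integer_points (\<Union>(config_complex k e C))"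
    then obtain F x where x: "x \<in> U k e C" and F: "F face_of ?cell x" "(\<chi> i. real_of_int (y $ i)) \<in> F"
      unfolding integer_points_def config_complex_def by blast
    have "(\<chi> i. real_of_int (y $ i)) \<in> ?cell x" using F face_of_imp_subset by blast
    then have "same_truncated ?N k (\<lambda>i. x $ e i) (\<lambda>i. y $ e i)"
      using of_int_in_cell[of ?N y k e] by (intro same_truncated_if_cells_meet) auto
    then show "y \<in> U k e C" using U_cong x by (metis less_add_one)
  qed
qed

lemma complex_dim_config_complex_all_stars:
  fixes e :: "nat \<Rightarrow> 'n::finite"
  assumes bij: "bij_betw e {0..k} (UNIV :: 'n set)"
  shows "complex_dim (config_complex k e {Star i | i. i < k}) = int (k + 1)"
proof -
  let ?N = "2 * int k + 1"
  let ?K = "config_complex k e {Star i | i. i < k}"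
  have inj: "inj_on e {0..k}" using bij by (rule bij_betw_imp_inj_on)
  have dim: "int DIM(real ^ 'n) = int (k + 1)" using bij_betw_same_card[OF bij] by simp
  define x :: "int ^ 'n" where "x = (\<chi> v. ?N * (int k - int (inv_into {0..k} e v)))"
  have x: "x $ e i = ?N * (int k - int i)" if "i \<le> k" for i
    using inv_into_f_f[OF inj, of i] that by (simp add: x_def)
  let ?P = "cell ?N k e (\<lambda>i. x $ e i)"
  have "polyhedron ?P"
    unfolding cell_def by (simp add: polyhedron_diff_polyhedron finite_cell_constraints)
  then have "?P face_of ?P" by (simp add: face_of_refl polyhedron_imp_convex)
  moreover have "x \<in> U k e {Star i | i. i < k}" by (rule steep_in_U[where N = ?N]) (use x in auto)
  ultimately have mem: "?P \<in> ?K" unfolding config_complex_def by blast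
  have "interior ?P \<noteq> {}" by (rule interior_steep_cell[OF _ inj]) (use x in auto)
  then have "aff_dim ?P = int DIM(real ^ 'n)" by (rule aff_dim_nonempty_interior)
  then have "int (k + 1) \<in> aff_dim ` ?K" using mem unfolding dim by (intro image_eqI[of _ _ ?P]) simp_all
  moreover have "finite ?K" using polyhedral_complex_config_complex unfolding polyhedral_complex_def by blast
  moreover have "d \<le> int (k + 1)" if "d \<in> aff_dim ` ?K" for d
    using that aff_dim_le_DIM unfolding dim[symmetric] by blast
  ultimately show ?thesis unfolding complex_dim_def by (intro Max_eqI) auto
qed

theorem theorem3p9:
  fixes k :: nat and e :: "nat \<Rightarrow> 'n::finite"
  assumes "k \<ge> 1"
    and "bij_betw e {0..k} (UNIV :: 'n set)"
  shows "disjoint_family_on (U k e) (configurations k)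
    \<and> (\<Union>C\<in>configurations k. U k e C) = UNIV - Sing k e
    \<and> (\<exists>K :: symb set \<Rightarrow> (real ^ 'n) set set.
         (\<forall>C\<in>configurations k.
            polyhedral_complex (K C)
            \<and> (\<forall>P\<in>K C. given_by_difference_constraints k e P)
            \<and> U k e C = integer_points (\<Union>(K C)))
         \<and> complex_dim (K {Star i | i. i < k}) = int (k + 1))"
proof (intro conjI exI ballI)
  show "disjoint_family_on (U k e) (configurations k)"
    unfolding disjoint_family_on_def U_def using has_configuration_unique by blast
  show "(\<Union>C\<in>configurations k. U k e C) = UNIV - Sing k e"
    using ex_configuration by (auto simp: U_def Sing_iff holonomic_iff)
  show "complex_dim (config_complex k e {Star i | i. i < k}) = int (k + 1)"
    by (rule complex_dim_config_complex_all_stars[OF assms(2)])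
qed (use polyhedral_complex_config_complex given_by_difference_constraints_config_complex
    U_eq_integer_points_config_complex in blast)+

end
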